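(* Let $K\ge1$ be an integer and $(z,x)\in\mathscr{R}_K\times\mathbb{R}^d$. (1) Let $w:\mathscr{D}_T\to\mathbb{R}$ be lower semicontinuous and set $w_K:=\Pi_K(w)$. Then $$\mathscr{P}^{1,2}_{K,-}w_K(z,x)\subset\mathscr{P}^{1,2}_-w(\mathfrak{o},x)\qquad\text{for all }\mathfrak{o}\in\mathscr{M}_K(w,z,x).$$ If additionally $w$ is lower coercive, then $$\overline{\mathscr{P}}^{1,2}_{K,-}w_K(z,x)\subset\bigcup_{\mathfrak{o}\in\mathscr{M}_K(w,z,x)}\overline{\mathscr{P}}^{1,2}_-w(\mathfrak{o},x).$$ (2) Let $u:\mathscr{D}_T\to\mathbb{R}$ be upper semicontinuous and set $u^K:=\Pi^K(u)$. Then $$\mathscr{P}^{1,2}_{K,+}u^K(z,x)\subset\mathscr{P}^{1,2}_+u(\mathfrak{o},x)\qquad\text{for all }\mathfrak{o}\in\mathscr{M}^K(u,z,x).$$ If additionally $u$ is upper coercive, then $$\overline{\mathscr{P}}^{1,2}_{K,+}u^K(z,x)\subset\bigcup_{\mathfrak{o}\in\mathscr{M}^K(u,z,x)}\overline{\mathscr{P}}^{1,2}_+u(\mathfrak{o},x).$$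
   Context: **Spaces.** Fix $d\ge 1$ and $T>0$. $\mathscr{M}$ is the space of finite signed Borel measures on $\mathbb{R}^d$ with the weak topology $\sigma(\mathscr{C}_b(\mathbb{R}^d),\mathscr{M})$, where $\mathscr{C}_b(\mathbb{R}^d)$ denotes bounded continuous functions; $\mathscr{M}_+$ are the nonnegative ones; $|\mathfrak{o}|$ is the total variation of $\mathfrak{o}$. Write $\mathfrak{o}(f)=\int f\,d\mathfrak{o}$. Let $q(x)=\sqrt{1+|x|^2}$, $\mathscr{M}_q=\{\mathfrak{o}\in\mathscr{M}_+:\mathfrak{o}(q)<\infty\}$ with the same weak topology, $\mathscr{M}_T=\{\mathfrak{o}\in\mathscr{M}_q:|\mathfrak{o}|\le T\}$, $\mathscr{D}=\mathscr{M}_q\times\mathbb{R}^d$ with the product topology, and $\mathscr{D}_T=\mathscr{M}_T\times\mathbb{R}^d$. $\mathbb{S}^d$ is the set of symmetric $d\times d$ matrices. **Separating family.** Fix $(f_k)_{k\ge 0}\subset\mathscr{C}^1_b(\mathbb{R}^d)$ separating $\mathscr{M}$ (i.e. $\mathfrak{o}(f_k)=\mathfrak{o}'(f_k)$ for all $k$ implies $\mathfrak{o}=\mathfrak{o}'$), with $f_0$ a (nonzero) constant function and $\sum_k\|f_k\|_{\mathscr{C}^1}^2\le 1$, where $\|f\|_{\mathscr{C}^1}=\|f\|_\infty+\|\nabla f\|_\infty$. **Coercivity.** An upper semicontinuous $u:\mathscr{D}_T\to\mathbb{R}$ is upper coercive if for every $c\in\mathbb{R}$ every sequence $(\xi_n)$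 in $\mathscr{D}_T$ with $u(\xi_n)\ge c$ has a subsequence converging in $\mathscr{D}_T$. A lower semicontinuous $w$ is lower coercive if for every $c\in\mathbb{R}$ every sequence $(\xi_n)$ with $w(\xi_n)\le c$ has a subsequence converging in $\mathscr{D}_T$. **Derivatives.** The occupation derivative of $\varphi:\mathscr{D}\to\mathbb{R}$ is $\partial_{\mathfrak{o}}\varphi(\mathfrak{o},x)=\lim_{h\downarrow0}\frac{\varphi(\mathfrak{o}+h\delta_x,x)-\varphi(\mathfrak{o},x)}{h}$, when the limit exists and is finite. $\mathscr{C}^{1,2}(\mathscr{D})$ is the set of continuous $\varphi:\mathscr{D}\to\mathbb{R}$ for which $\partial_{\mathfrak{o}}\varphi$, $\nabla\varphi$, $\nabla^2\varphi$ (gradient and Hessian in $x$) exist and are continuous on $\mathscr{D}$. $\mathscr{C}^{1,2}(\mathscr{D}_T)$ denotes the restrictions to $\mathscr{D}_T$ of functions in $\mathscr{C}^{1,2}(\mathscr{D})$ (with derivatives those of the extension). **Semijets on $\mathscr{D}_T$.** For $u$ upper semicontinuous and $(\mathfrak{o},x)\in\mathscr{D}_T$, $\mathscr{P}^{1,2}_+u(\mathfrak{o},x)\subset\mathbb{R}\times\mathbb{R}^d\times\mathbb{S}^d$ is the set of $(\partial_{\mathfrak{o}}\phi,\nabla\phi,\nabla^2\phi)(\mathfrak{o},x)$ with $\phi\in\mathscr{C}^{1,2}(\mathscr{D}_T)$ and $0=(u-\phi)(\mathfrak{o},x)=\max_{\mathscr{D}_T}(u-\phi)$. For $w$ lower semicontinuous,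 $\mathscr{P}^{1,2}_-w(\mathfrak{o},x)$ is defined the same way with $0=(w-\phi)(\mathfrak{o},x)=\min_{\mathscr{D}_T}(w-\phi)$. Closures: $\overline{\mathscr{P}}^{1,2}_\pm v(\mathfrak{o},x)=\{\lim_n\zeta_n:\ \zeta_n\in\mathscr{P}^{1,2}_\pm v(\mathfrak{o}_n,x_n),\ (\mathfrak{o}_n,x_n,v(\mathfrak{o}_n,x_n))\to(\mathfrak{o},x,v(\mathfrak{o},x))\}$. **Finite-dimensional projections.** $\pi_K(\mathfrak{o})=(\mathfrak{o}(f_1),\dots,\mathfrak{o}(f_K))$ and $\mathscr{R}_K=\pi_K(\mathscr{M}_T)\subset\mathbb{R}^K$. For $v:\mathscr{D}_T\to\mathbb{R}$ and $(z,x)\in\mathscr{R}_K\times\mathbb{R}^d$, $$\Pi^K(v)(z,x)=\sup\{v(\mathfrak{o},x):\mathfrak{o}\in\mathscr{M}_T,\ \pi_K(\mathfrak{o})=z\},\quad\Pi_K(v)(z,x)=\inf\{v(\mathfrak{o},x):\mathfrak{o}\in\mathscr{M}_T,\ \pi_K(\mathfrak{o})=z\}.$$ $\mathscr{M}^K(v,z,x)$ and $\mathscr{M}_K(v,z,x)$ are the (possibly empty) sets of maximizers of the first and minimizers of the second expression, respectively. **Semijets on $\mathscr{R}_K\times\mathbb{R}^d$.** For a function $\tilde v$ on $\mathscr{R}_K\times\mathbb{R}^d$ and $(z,x)\in\mathscr{R}_K\times\mathbb{R}^d$ (not necessarily interior), $\mathscr{P}^{1,2}_+\tilde v(z,x)$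 (resp. $\mathscr{P}^{1,2}_-\tilde v(z,x)$) $\subset\mathbb{R}^K\times\mathbb{R}^d\times\mathbb{S}^d$ is the set of $(\nabla_z\phi,\nabla_x\phi,\nabla_x^2\phi)(z,x)$ with $\phi\in\mathscr{C}^{1,2}(\mathbb{R}^K\times\mathbb{R}^d)$ (continuous with continuous $\nabla_z\phi,\nabla_x\phi,\nabla_x^2\phi$) and $0=(\tilde v-\phi)(z,x)=\max_{\mathscr{R}_K\times\mathbb{R}^d}(\tilde v-\phi)$ (resp. $=\min_{\mathscr{R}_K\times\mathbb{R}^d}(\tilde v-\phi)$). The closures $\overline{\mathscr{P}}^{1,2}_\pm\tilde v(z,x)$ consist of limits of $\zeta_n\in\mathscr{P}^{1,2}_\pm\tilde v(z_n,x_n)$ with $(z_n,x_n,\tilde v(z_n,x_n))\to(z,x,\tilde v(z,x))$. Finally, $$\mathscr{P}^{1,2}_{K,\pm}\tilde v(z,x)=\{(\tilde\theta\cdot(f_1(x),\dots,f_K(x)),\Delta,\Gamma):(\tilde\theta,\Delta,\Gamma)\in\mathscr{P}^{1,2}_\pm\tilde v(z,x)\}\subset\mathbb{R}\times\mathbb{R}^d\times\mathbb{S}^d,$$ and $\overline{\mathscr{P}}^{1,2}_{K,\pm}\tilde v(z,x)$ is defined in the same way from $\overline{\mathscr{P}}^{1,2}_\pm\tilde v(z,x)$. *)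

theory Defs
  imports "HOL-Probability.Probability"
begin

text \<open>
  \<open>\<real>\<^sup>d\<close> is \<open>real ^ 'd\<close> with \<open>d = CARD('d)\<close>. Nonnegative finite Borel measures are elements of the
  library type of measures with \<open>sets \<mu> = sets borel\<close> (hence \<open>space \<mu> = UNIV\<close>); for such \<open>\<mu>\<close> the total
  variation is \<open>measure \<mu> UNIV\<close>. Functions on \<open>\<D>\<close> and \<open>\<D>\<^sub>T\<close> are total functions on pairs whose
  values outside these sets are never used.
\<close>

section \<open>Spaces of measures\<close>

definition fin_borel_measures :: "(real ^ 'd) measure set" where
  "fin_borel_measures = {\<mu>. sets \<mu> = sets borel \<and> finite_measure \<mu>}"

text \<open>Initial topology of the maps \<open>\<mu> \<mapsto> \<integral>f d\<mu>\<close> for bounded continuous \<open>f\<close>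
  (\<open>euclidean\<close> on a function type is the product topology).\<close>

definition weak_topology :: "(real ^ 'd) measure topology" where
  "weak_topology =
     pullback_topology fin_borel_measures
       (\<lambda>\<mu> (f :: (real ^ 'd) \<Rightarrow>\<^sub>C real). \<integral>y. apply_bcontfun f y \<partial>\<mu>) euclidean"

definition qfun :: "real ^ 'd \<Rightarrow> real" where
  "qfun x = sqrt (1 + (norm x)\<^sup>2)"

definition Mq :: "(real ^ 'd) measure set" where
  "Mq = {\<mu> \<in> fin_borel_measures. (\<integral>\<^sup>+y. ennreal (qfun y) \<partial>\<mu>) < \<infinity>}"

definition MT :: "real \<Rightarrow> (real ^ 'd) measure set" where
  "MT T = {\<mu> \<in> Mq. measure \<mu> UNIV \<le> T}"

definition D_top :: "((real ^ 'd) measure \<times> (real ^ 'd)) topology" where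
  "D_top = prod_topology (subtopology weak_topology Mq) euclidean"

definition DT_top :: "real \<Rightarrow> ((real ^ 'd) measure \<times> (real ^ 'd)) topology" where
  "DT_top T = prod_topology (subtopology weak_topology (MT T)) euclidean"

definition DT :: "real \<Rightarrow> ((real ^ 'd) measure \<times> (real ^ 'd)) set" where
  "DT T = MT T \<times> UNIV"


section \<open>Finite signed measures and the separating family\<close>

text \<open>A finite signed Borel measure is a real-valued countably additive set function on the Borel
  sets; its integral is taken with respect to its Jordan decomposition
  \<open>\<sigma>\<^sup>\<plusminus>(A) = sup {\<plusminus>\<sigma>(B) | B \<subseteq> A Borel}\<close>. The values of \<open>\<sigma>\<close> on non-Borel sets are irrelevant.\<close>

definition signed_borel_measure :: "((real ^ 'd) set \<Rightarrow> real) \<Rightarrow> bool" where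
  "signed_borel_measure \<sigma> \<longleftrightarrow>
     \<sigma> {} = 0 \<and>
     (\<forall>A :: nat \<Rightarrow> (real ^ 'd) set. range A \<subseteq> sets borel \<and> disjoint_family A \<longrightarrow>
        (\<lambda>n. \<sigma> (A n)) sums \<sigma> (\<Union>n. A n))"

definition pos_variation :: "((real ^ 'd) set \<Rightarrow> real) \<Rightarrow> (real ^ 'd) measure" where
  "pos_variation \<sigma> =
     measure_of UNIV (sets borel) (\<lambda>A. SUP B\<in>{B \<in> sets borel. B \<subseteq> A}. ennreal (\<sigma> B))"

definition signed_integral :: "((real ^ 'd) set \<Rightarrow> real) \<Rightarrow> (real ^ 'd \<Rightarrow> real) \<Rightarrow> real" where
  "signed_integral \<sigma> f =
     (\<integral>y. f y \<partial>pos_variation \<sigma>) - (\<integral>y. f y \<partial>pos_variation (\<lambda>A. - \<sigma> A))"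

definition gradient :: "('a::real_inner \<Rightarrow> real) \<Rightarrow> 'a \<Rightarrow> 'a" where
  "gradient f x = (THE D. GDERIV f x :> D)"

definition hessian :: "(real ^ 'd \<Rightarrow> real) \<Rightarrow> real ^ 'd \<Rightarrow> real ^ 'd ^ 'd" where
  "hessian f x = jacobian (gradient f) (at x)"

definition C1b :: "(real ^ 'd \<Rightarrow> real) set" where
  "C1b = {f. f \<in> bcontfun \<and> (\<forall>x. f differentiable (at x)) \<and> gradient f \<in> bcontfun}"

definition C1_norm :: "(real ^ 'd \<Rightarrow> real) \<Rightarrow> real" where
  "C1_norm f = (SUP x. \<bar>f x\<bar>) + (SUP x. norm (gradient f x))"

definition separating_family :: "(nat \<Rightarrow> real ^ 'd \<Rightarrow> real) \<Rightarrow> bool" where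
  "separating_family f \<longleftrightarrow>
     (\<forall>k. f k \<in> C1b) \<and>
     (\<forall>\<sigma> \<sigma>'. signed_borel_measure \<sigma> \<and> signed_borel_measure \<sigma>' \<and>
        (\<forall>k. signed_integral \<sigma> (f k) = signed_integral \<sigma>' (f k)) \<longrightarrow>
        (\<forall>A\<in>sets borel. \<sigma> A = \<sigma>' A)) \<and>
     (\<exists>c. c \<noteq> 0 \<and> f 0 = (\<lambda>_. c)) \<and>
     summable (\<lambda>k. (C1_norm (f k))\<^sup>2) \<and> (\<Sum>k. (C1_norm (f k))\<^sup>2) \<le> 1"


section \<open>Semicontinuity and coercivity\<close>

definition lsc :: "'a topology \<Rightarrow> ('a \<Rightarrow> real) \<Rightarrow> bool" where
  "lsc X w \<longleftrightarrow> (\<forall>c. openin X {\<xi> \<in> topspace X. w \<xi> > c})"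

definition usc :: "'a topology \<Rightarrow> ('a \<Rightarrow> real) \<Rightarrow> bool" where
  "usc X u \<longleftrightarrow> (\<forall>c. openin X {\<xi> \<in> topspace X. u \<xi> < c})"

definition lower_coercive ::
  "real \<Rightarrow> ((real ^ 'd) measure \<times> (real ^ 'd) \<Rightarrow> real) \<Rightarrow> bool" where
  "lower_coercive T w \<longleftrightarrow> lsc (DT_top T) w \<and>
     (\<forall>c \<xi>. (\<forall>n::nat. \<xi> n \<in> DT T \<and> w (\<xi> n) \<le> c) \<longrightarrow>
        (\<exists>r l. strict_mono r \<and> limitin (DT_top T) (\<xi> \<circ> r) l sequentially))"

definition upper_coercive ::
  "real \<Rightarrow> ((real ^ 'd) measure \<times> (real ^ 'd) \<Rightarrow> real) \<Rightarrow> bool" where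
  "upper_coercive T u \<longleftrightarrow> usc (DT_top T) u \<and>
     (\<forall>c \<xi>. (\<forall>n::nat. \<xi> n \<in> DT T \<and> u (\<xi> n) \<ge> c) \<longrightarrow>
        (\<exists>r l. strict_mono r \<and> limitin (DT_top T) (\<xi> \<circ> r) l sequentially))"


section \<open>Derivatives and smooth functions on \<open>\<D>\<close>\<close>

definition add_measure :: "'a measure \<Rightarrow> 'a measure \<Rightarrow> 'a measure" where
  "add_measure \<mu> \<nu> = measure_of (space \<mu>) (sets \<mu>) (\<lambda>A. emeasure \<mu> A + emeasure \<nu> A)"

definition occ_quotient ::
  "((real ^ 'd) measure \<times> (real ^ 'd) \<Rightarrow> real) \<Rightarrow> (real ^ 'd) measure \<times> (real ^ 'd)
     \<Rightarrow> real \<Rightarrow> real" where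
  "occ_quotient \<phi> = (\<lambda>(\<mu>, x) h.
     (\<phi> (add_measure \<mu> (scale_measure (ennreal h) (return borel x)), x) - \<phi> (\<mu>, x)) / h)"

definition occ_differentiable ::
  "((real ^ 'd) measure \<times> (real ^ 'd) \<Rightarrow> real) \<Rightarrow> (real ^ 'd) measure \<times> (real ^ 'd) \<Rightarrow> bool" where
  "occ_differentiable \<phi> \<xi> \<longleftrightarrow> (\<exists>L. (occ_quotient \<phi> \<xi> \<longlongrightarrow> L) (at_right 0))"

definition occ_deriv ::
  "((real ^ 'd) measure \<times> (real ^ 'd) \<Rightarrow> real) \<Rightarrow> (real ^ 'd) measure \<times> (real ^ 'd) \<Rightarrow> real" where
  "occ_deriv \<phi> \<xi> = Lim (at_right 0) (occ_quotient \<phi> \<xi>)"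

definition grad_x :: "('m \<times> (real ^ 'd) \<Rightarrow> real) \<Rightarrow> 'm \<times> (real ^ 'd) \<Rightarrow> real ^ 'd" where
  "grad_x \<phi> = (\<lambda>(m, x). gradient (\<lambda>y. \<phi> (m, y)) x)"

definition hess_x :: "('m \<times> (real ^ 'd) \<Rightarrow> real) \<Rightarrow> 'm \<times> (real ^ 'd) \<Rightarrow> real ^ 'd ^ 'd" where
  "hess_x \<phi> = (\<lambda>(m, x). hessian (\<lambda>y. \<phi> (m, y)) x)"

definition twice_differentiable_x ::
  "('m \<times> (real ^ 'd) \<Rightarrow> real) \<Rightarrow> 'm \<times> (real ^ 'd) \<Rightarrow> bool" where
  "twice_differentiable_x \<phi> = (\<lambda>(m, x).
     (\<forall>y. (\<lambda>y. \<phi> (m, y)) differentiable (at y)) \<and>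
     gradient (\<lambda>y. \<phi> (m, y)) differentiable (at x))"

definition C12_D :: "((real ^ 'd) measure \<times> (real ^ 'd) \<Rightarrow> real) set" where
  "C12_D = {\<phi>. continuous_map D_top euclidean \<phi> \<and>
     (\<forall>\<xi> \<in> Mq \<times> UNIV. occ_differentiable \<phi> \<xi> \<and> twice_differentiable_x \<phi> \<xi>) \<and>
     continuous_map D_top euclidean (occ_deriv \<phi>) \<and>
     continuous_map D_top euclidean (grad_x \<phi>) \<and>
     continuous_map D_top euclidean (hess_x \<phi>)}"


section \<open>Semijets on \<open>\<D>\<^sub>T\<close>\<close>

text \<open>Test functions on \<open>\<D>\<^sub>T\<close> are restrictions of functions in \<open>C12_D\<close>, with the derivatives of the
  extension, so it suffices to range over the extensions. Matrix components of semijets are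
  symmetric because the Hessians involved are continuous in \<open>x\<close>.\<close>

definition jet_plus ::
  "real \<Rightarrow> ((real ^ 'd) measure \<times> (real ^ 'd) \<Rightarrow> real) \<Rightarrow> (real ^ 'd) measure \<times> (real ^ 'd)
     \<Rightarrow> (real \<times> (real ^ 'd) \<times> (real ^ 'd ^ 'd)) set" where
  "jet_plus T u \<xi> = {(occ_deriv \<phi> \<xi>, grad_x \<phi> \<xi>, hess_x \<phi> \<xi>) | \<phi>.
     \<phi> \<in> C12_D \<and> \<xi> \<in> DT T \<and> u \<xi> - \<phi> \<xi> = 0 \<and> (\<forall>\<eta> \<in> DT T. u \<eta> - \<phi> \<eta> \<le> 0)}"

definition jet_minus ::
  "real \<Rightarrow> ((real ^ 'd) measure \<times> (real ^ 'd) \<Rightarrow> real) \<Rightarrow> (real ^ 'd) measure \<times> (real ^ 'd)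
     \<Rightarrow> (real \<times> (real ^ 'd) \<times> (real ^ 'd ^ 'd)) set" where
  "jet_minus T w \<xi> = {(occ_deriv \<phi> \<xi>, grad_x \<phi> \<xi>, hess_x \<phi> \<xi>) | \<phi>.
     \<phi> \<in> C12_D \<and> \<xi> \<in> DT T \<and> w \<xi> - \<phi> \<xi> = 0 \<and> (\<forall>\<eta> \<in> DT T. w \<eta> - \<phi> \<eta> \<ge> 0)}"

text \<open>Limits of elements of \<open>P (\<xi>\<^sub>n)\<close> along sequences with \<open>(\<xi>\<^sub>n, v \<xi>\<^sub>n) \<rightarrow> (\<xi>, v \<xi>)\<close>; used for all the
  semijet families below (each of which is empty outside its domain).\<close>

definition jet_closure ::
  "'p topology \<Rightarrow> ('p \<Rightarrow> 'v::topological_space) \<Rightarrow> ('p \<Rightarrow> 'j::topological_space set) \<Rightarrow> 'p \<Rightarrow> 'j set" where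
  "jet_closure X v P \<xi> = {\<zeta>. \<exists>\<xi>s \<zeta>s.
     (\<forall>n::nat. \<zeta>s n \<in> P (\<xi>s n)) \<and> limitin X \<xi>s \<xi> sequentially \<and>
     (\<lambda>n. v (\<xi>s n)) \<longlonglongrightarrow> v \<xi> \<and> \<zeta>s \<longlonglongrightarrow> \<zeta>}"

definition jet_plus_bar ::
  "real \<Rightarrow> ((real ^ 'd) measure \<times> (real ^ 'd) \<Rightarrow> real) \<Rightarrow> (real ^ 'd) measure \<times> (real ^ 'd)
     \<Rightarrow> (real \<times> (real ^ 'd) \<times> (real ^ 'd ^ 'd)) set" where
  "jet_plus_bar T u = jet_closure (DT_top T) u (jet_plus T u)"

definition jet_minus_bar ::
  "real \<Rightarrow> ((real ^ 'd) measure \<times> (real ^ 'd) \<Rightarrow> real) \<Rightarrow> (real ^ 'd) measure \<times> (real ^ 'd)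
     \<Rightarrow> (real \<times> (real ^ 'd) \<times> (real ^ 'd ^ 'd)) set" where
  "jet_minus_bar T w = jet_closure (DT_top T) w (jet_minus T w)"


section \<open>Finite-dimensional projections\<close>

text \<open>\<open>\<real>\<^sup>K\<close> is \<open>real ^ 'k\<close>, where \<open>idx\<close> is a bijection from \<open>'k\<close> onto \<open>{1..K}\<close>: the coordinate \<open>j :: 'k\<close>
  carries the number \<open>idx j\<close>. The extrema below are taken in \<open>ereal\<close> because they may be infinite.\<close>

definition evalK :: "(nat \<Rightarrow> real ^ 'd \<Rightarrow> real) \<Rightarrow> ('k \<Rightarrow> nat) \<Rightarrow> real ^ 'd \<Rightarrow> real ^ 'k" where
  "evalK f idx x = (\<chi> j. f (idx j) x)"

definition piK :: "(nat \<Rightarrow> real ^ 'd \<Rightarrow> real) \<Rightarrow> ('k \<Rightarrow> nat) \<Rightarrow> (real ^ 'd) measure \<Rightarrow> real ^ 'k" where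
  "piK f idx \<mu> = (\<chi> j. \<integral>y. f (idx j) y \<partial>\<mu>)"

definition RK :: "real \<Rightarrow> (nat \<Rightarrow> real ^ 'd \<Rightarrow> real) \<Rightarrow> ('k \<Rightarrow> nat) \<Rightarrow> (real ^ 'k) set" where
  "RK T f idx = piK f idx ` MT T"

definition Pi_sup ::
  "real \<Rightarrow> (nat \<Rightarrow> real ^ 'd \<Rightarrow> real) \<Rightarrow> ('k \<Rightarrow> nat) \<Rightarrow>
   ((real ^ 'd) measure \<times> (real ^ 'd) \<Rightarrow> real) \<Rightarrow> (real ^ 'k) \<times> (real ^ 'd) \<Rightarrow> ereal" where
  "Pi_sup T f idx v = (\<lambda>(z, x). SUP \<mu>\<in>{\<mu> \<in> MT T. piK f idx \<mu> = z}. ereal (v (\<mu>, x)))"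

definition Pi_inf ::
  "real \<Rightarrow> (nat \<Rightarrow> real ^ 'd \<Rightarrow> real) \<Rightarrow> ('k \<Rightarrow> nat) \<Rightarrow>
   ((real ^ 'd) measure \<times> (real ^ 'd) \<Rightarrow> real) \<Rightarrow> (real ^ 'k) \<times> (real ^ 'd) \<Rightarrow> ereal" where
  "Pi_inf T f idx v = (\<lambda>(z, x). INF \<mu>\<in>{\<mu> \<in> MT T. piK f idx \<mu> = z}. ereal (v (\<mu>, x)))"

definition maximizers ::
  "real \<Rightarrow> (nat \<Rightarrow> real ^ 'd \<Rightarrow> real) \<Rightarrow> ('k \<Rightarrow> nat) \<Rightarrow>
   ((real ^ 'd) measure \<times> (real ^ 'd) \<Rightarrow> real) \<Rightarrow> real ^ 'k \<Rightarrow> real ^ 'd \<Rightarrow> (real ^ 'd) measure set" where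
  "maximizers T f idx v z x =
     {\<mu> \<in> MT T. piK f idx \<mu> = z \<and> ereal (v (\<mu>, x)) = Pi_sup T f idx v (z, x)}"

definition minimizers ::
  "real \<Rightarrow> (nat \<Rightarrow> real ^ 'd \<Rightarrow> real) \<Rightarrow> ('k \<Rightarrow> nat) \<Rightarrow>
   ((real ^ 'd) measure \<times> (real ^ 'd) \<Rightarrow> real) \<Rightarrow> real ^ 'k \<Rightarrow> real ^ 'd \<Rightarrow> (real ^ 'd) measure set" where
  "minimizers T f idx v z x =
     {\<mu> \<in> MT T. piK f idx \<mu> = z \<and> ereal (v (\<mu>, x)) = Pi_inf T f idx v (z, x)}"


section \<open>Semijets on \<open>R \<times> \<real>\<^sup>d\<close> with \<open>R \<subseteq> \<real>\<^sup>K\<close>\<close>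

definition grad_z :: "((real ^ 'k) \<times> 'b \<Rightarrow> real) \<Rightarrow> (real ^ 'k) \<times> 'b \<Rightarrow> real ^ 'k" where
  "grad_z \<phi> = (\<lambda>(z, x). gradient (\<lambda>y. \<phi> (y, x)) z)"

definition C12_fin :: "((real ^ 'k) \<times> (real ^ 'd) \<Rightarrow> real) set" where
  "C12_fin = {\<phi>. continuous_on UNIV \<phi> \<and>
     (\<forall>z x. (\<lambda>y. \<phi> (y, x)) differentiable (at z) \<and> twice_differentiable_x \<phi> (z, x)) \<and>
     continuous_on UNIV (grad_z \<phi>) \<and>
     continuous_on UNIV (grad_x \<phi>) \<and>
     continuous_on UNIV (hess_x \<phi>)}"

definition jet_plus_fin ::
  "(real ^ 'k) set \<Rightarrow> ((real ^ 'k) \<times> (real ^ 'd) \<Rightarrow> ereal) \<Rightarrow> (real ^ 'k) \<times> (real ^ 'd)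
     \<Rightarrow> ((real ^ 'k) \<times> (real ^ 'd) \<times> (real ^ 'd ^ 'd)) set" where
  "jet_plus_fin R v p = {(grad_z \<phi> p, grad_x \<phi> p, hess_x \<phi> p) | \<phi>.
     \<phi> \<in> C12_fin \<and> p \<in> R \<times> UNIV \<and> v p - ereal (\<phi> p) = 0 \<and>
     (\<forall>r \<in> R \<times> UNIV. v r - ereal (\<phi> r) \<le> 0)}"

definition jet_minus_fin ::
  "(real ^ 'k) set \<Rightarrow> ((real ^ 'k) \<times> (real ^ 'd) \<Rightarrow> ereal) \<Rightarrow> (real ^ 'k) \<times> (real ^ 'd)
     \<Rightarrow> ((real ^ 'k) \<times> (real ^ 'd) \<times> (real ^ 'd ^ 'd)) set" where
  "jet_minus_fin R v p = {(grad_z \<phi> p, grad_x \<phi> p, hess_x \<phi> p) | \<phi>.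
     \<phi> \<in> C12_fin \<and> p \<in> R \<times> UNIV \<and> v p - ereal (\<phi> p) = 0 \<and>
     (\<forall>r \<in> R \<times> UNIV. v r - ereal (\<phi> r) \<ge> 0)}"

definition jet_plus_fin_bar ::
  "(real ^ 'k) set \<Rightarrow> ((real ^ 'k) \<times> (real ^ 'd) \<Rightarrow> ereal) \<Rightarrow> (real ^ 'k) \<times> (real ^ 'd)
     \<Rightarrow> ((real ^ 'k) \<times> (real ^ 'd) \<times> (real ^ 'd ^ 'd)) set" where
  "jet_plus_fin_bar R v = jet_closure (top_of_set (R \<times> UNIV)) v (jet_plus_fin R v)"

definition jet_minus_fin_bar ::
  "(real ^ 'k) set \<Rightarrow> ((real ^ 'k) \<times> (real ^ 'd) \<Rightarrow> ereal) \<Rightarrow> (real ^ 'k) \<times> (real ^ 'd)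
     \<Rightarrow> ((real ^ 'k) \<times> (real ^ 'd) \<times> (real ^ 'd ^ 'd)) set" where
  "jet_minus_fin_bar R v = jet_closure (top_of_set (R \<times> UNIV)) v (jet_minus_fin R v)"

text \<open>The map \<open>(\<theta>, \<Delta>, \<Gamma>) \<mapsto> (\<theta> \<cdot> (f\<^sub>1(x), \<dots>, f\<^sub>K(x)), \<Delta>, \<Gamma>)\<close> which turns semijets on
  \<open>\<R>\<^sub>K \<times> \<real>\<^sup>d\<close> into the sets \<open>\<P>\<^sub>K\<close>.\<close>

definition contract ::
  "(nat \<Rightarrow> real ^ 'd \<Rightarrow> real) \<Rightarrow> ('k \<Rightarrow> nat) \<Rightarrow> real ^ 'd
     \<Rightarrow> (real ^ 'k) \<times> (real ^ 'd) \<times> (real ^ 'd ^ 'd) \<Rightarrow> real \<times> (real ^ 'd) \<times> (real ^ 'd ^ 'd)" where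
  "contract f idx x = (\<lambda>(\<theta>, \<Delta>, \<Gamma>). (\<theta> \<bullet> evalK f idx x, \<Delta>, \<Gamma>))"

definition jetK_plus ::
  "real \<Rightarrow> (nat \<Rightarrow> real ^ 'd \<Rightarrow> real) \<Rightarrow> ('k \<Rightarrow> nat) \<Rightarrow> ((real ^ 'k) \<times> (real ^ 'd) \<Rightarrow> ereal)
     \<Rightarrow> real ^ 'k \<Rightarrow> real ^ 'd \<Rightarrow> (real \<times> (real ^ 'd) \<times> (real ^ 'd ^ 'd)) set" where
  "jetK_plus T f idx v z x = contract f idx x ` jet_plus_fin (RK T f idx) v (z, x)"

definition jetK_minus ::
  "real \<Rightarrow> (nat \<Rightarrow> real ^ 'd \<Rightarrow> real) \<Rightarrow> ('k \<Rightarrow> nat) \<Rightarrow> ((real ^ 'k) \<times> (real ^ 'd) \<Rightarrow> ereal)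
     \<Rightarrow> real ^ 'k \<Rightarrow> real ^ 'd \<Rightarrow> (real \<times> (real ^ 'd) \<times> (real ^ 'd ^ 'd)) set" where
  "jetK_minus T f idx v z x = contract f idx x ` jet_minus_fin (RK T f idx) v (z, x)"

definition jetK_plus_bar ::
  "real \<Rightarrow> (nat \<Rightarrow> real ^ 'd \<Rightarrow> real) \<Rightarrow> ('k \<Rightarrow> nat) \<Rightarrow> ((real ^ 'k) \<times> (real ^ 'd) \<Rightarrow> ereal)
     \<Rightarrow> real ^ 'k \<Rightarrow> real ^ 'd \<Rightarrow> (real \<times> (real ^ 'd) \<times> (real ^ 'd ^ 'd)) set" where
  "jetK_plus_bar T f idx v z x = contract f idx x ` jet_plus_fin_bar (RK T f idx) v (z, x)"

definition jetK_minus_bar ::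
  "real \<Rightarrow> (nat \<Rightarrow> real ^ 'd \<Rightarrow> real) \<Rightarrow> ('k \<Rightarrow> nat) \<Rightarrow> ((real ^ 'k) \<times> (real ^ 'd) \<Rightarrow> ereal)
     \<Rightarrow> real ^ 'k \<Rightarrow> real ^ 'd \<Rightarrow> (real \<times> (real ^ 'd) \<times> (real ^ 'd ^ 'd)) set" where
  "jetK_minus_bar T f idx v z x = contract f idx x ` jet_minus_fin_bar (RK T f idx) v (z, x)"

end

theory Submission
  imports Defs
begin

text \<open>
  If \<open>\<phi>\<close> touches \<open>\<Pi>\<^sub>K w\<close> from below at \<open>(z, x)\<close>, then \<open>(\<mu>, y) \<mapsto> \<phi> (\<pi>\<^sub>K \<mu>, y)\<close> touches \<open>w\<close> from below at
  \<open>(\<mu>, x)\<close> for every minimizer \<open>\<mu>\<close>, and its occupation derivative is \<open>\<nabla>\<^sub>z \<phi> \<cdot> (f\<^sub>1 x, \<dots>, f\<^sub>K x)\<close> because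
  \<open>\<pi>\<^sub>K\<close> is affine along \<open>h \<mapsto> \<mu> + h \<delta>\<^sub>x\<close>. For the closures, coercivity and lower semicontinuity provide
  minimizers over the approximating points and make them subconverge to a minimizer over the limit
  point, along which the values of \<open>w\<close> converge.
\<close>

section \<open>Integration against sums of measures\<close>

lemma sets_add_measure: "sets (add_measure \<mu> \<nu>) = sets \<mu>"
  by (simp add: add_measure_def sets.sigma_sets_eq sets.space_closed)

lemma space_add_measure: "space (add_measure \<mu> \<nu>) = space \<mu>"
  by (simp add: add_measure_def sets.space_closed)

text \<open>\<open>measure_of\<close> yields the zero measure unless its set function is a measure,
  so this formula rests on countable additivity, obtained by splitting a series in
  \<open>ennreal\<close>.\<close>

lemma emeasure_add_measure:
  assumes "sets \<nu> = sets \<mu>" "A \<in> sets \<mu>"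
  shows "emeasure (add_measure \<mu> \<nu>) A = emeasure \<mu> A + emeasure \<nu> A"
proof (rule emeasure_measure_of[OF add_measure_def])
  show "countably_additive (sets (add_measure \<mu> \<nu>)) (\<lambda>A. emeasure \<mu> A + emeasure \<nu> A)"
    unfolding countably_additive_def sets_add_measure
  proof (intro allI impI)
    fix A :: "nat \<Rightarrow> 'a set"
    assume A: "range A \<subseteq> sets \<mu>" "disjoint_family A"
    have "(\<Sum>i. emeasure \<mu> (A i) + emeasure \<nu> (A i)) = (\<Sum>i. emeasure \<mu> (A i)) + (\<Sum>i. emeasure \<nu> (A i))"
      by (rule suminf_add[symmetric]) auto
    then show "(\<Sum>i. emeasure \<mu> (A i) + emeasure \<nu> (A i)) = emeasure \<mu> (\<Union> (range A)) + emeasure \<nu> (\<Union> (range A))"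
      using A assms(1) by (simp add: suminf_emeasure)
  qed
qed (use assms in \<open>auto simp: sets_add_measure positive_def dest: sets.sets_into_space\<close>)

text \<open>By induction on the measurable integrand: indicators reduce to
  \<open>emeasure_add_measure\<close>, and the claim survives scaling, sums and increasing
  limits.\<close>

lemma nn_integral_add_measure:
  assumes sets: "sets \<nu> = sets \<mu>" and g: "g \<in> borel_measurable \<mu>"
  shows "(\<integral>\<^sup>+y. g y \<partial>add_measure \<mu> \<nu>) = (\<integral>\<^sup>+y. g y \<partial>\<mu>) + (\<integral>\<^sup>+y. g y \<partial>\<nu>)"
  using g
proof induction
  note [measurable_cong] = sets sets_add_measure
  {
    case (cong f g)
    then show ?case
      using sets_eq_imp_space_eq[OF sets]
      by (simp add: space_add_measure cong: nn_integral_cong_simp)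
  next
    case (set A)
    then show ?case
      by (simp add: sets sets_add_measure emeasure_add_measure)
  next
    case (mult f c)
    have [measurable]: "f \<in> borel_measurable \<mu>" by fact
    show ?case using mult.IH
      by (simp add: nn_integral_cmult distrib_left)
  next
    case (add f g)
    have [measurable]: "f \<in> borel_measurable \<mu>" "g \<in> borel_measurable \<mu>" by fact+
    show ?case using add.IH
      by (simp add: nn_integral_add ac_simps)
  next
    case (seq U)
    have [measurable]: "\<And>i. U i \<in> borel_measurable \<mu>" by fact
    have inc: "incseq (\<lambda>i. integral\<^sup>N M (U i))" for M
      using \<open>incseq U\<close> by (auto simp: incseq_def le_fun_def intro!: nn_integral_mono)
    show ?case using seq.IH \<open>incseq U\<close>
      by (simp add: image_comp nn_integral_monotone_convergence_SUP ennreal_SUP_add[OF inc inc])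
  }
qed

lemma integrable_add_measure:
  fixes g :: "'a \<Rightarrow> real"
  assumes "sets \<nu> = sets \<mu>" "integrable \<mu> g" "integrable \<nu> g"
  shows "integrable (add_measure \<mu> \<nu>) g"
proof -
  have [measurable]: "g \<in> borel_measurable \<mu>" using assms(2) by simp
  have "g \<in> borel_measurable (add_measure \<mu> \<nu>)"
    by (simp add: measurable_cong_sets[OF sets_add_measure refl])
  then show ?thesis
    using assms(2,3) by (simp add: integrable_iff_bounded nn_integral_add_measure[OF assms(1)])
qed

text \<open>The positive and negative parts of \<open>g\<close> are treated separately by the
  nonnegative case; integrability makes all four integrals finite, which is what lets
  \<open>enn2real\<close> distribute over the sums.\<close>

lemma integral_add_measure:
  fixes g :: "'a \<Rightarrow> real"
  assumes "sets \<nu> = sets \<mu>" "integrable \<mu> g" "integrable \<nu> g"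
  shows "(\<integral>y. g y \<partial>add_measure \<mu> \<nu>) = (\<integral>y. g y \<partial>\<mu>) + (\<integral>y. g y \<partial>\<nu>)"
proof -
  have [measurable]: "g \<in> borel_measurable \<mu>" using assms(2) by simp
  note fin = assms(2,3)[unfolded real_integrable_def]
  show ?thesis
    using fin
    by (simp add: real_lebesgue_integral_def assms integrable_add_measure
        nn_integral_add_measure[OF assms(1)] enn2real_plus less_top)
qed

lemma integrable_scale_measure:
  fixes g :: "'a \<Rightarrow> real"
  assumes "integrable M g" "0 \<le> r"
  shows "integrable (scale_measure (ennreal r) M) g"
proof -
  have [measurable]: "g \<in> borel_measurable M" using assms(1) by simp
  then show ?thesis
    using assms by (simp add: integrable_iff_bounded nn_integral_scale_measure ennreal_mult_less_top)
qed

lemma integral_scale_measure: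
  fixes g :: "'a \<Rightarrow> real"
  assumes "integrable M g" "0 \<le> r"
  shows "(\<integral>y. g y \<partial>scale_measure (ennreal r) M) = r * (\<integral>y. g y \<partial>M)"
proof -
  have [measurable]: "g \<in> borel_measurable M" using assms(1) by simp
  show ?thesis
    using assms
    by (simp add: real_lebesgue_integral_def integrable_scale_measure nn_integral_scale_measure
        enn2real_mult right_diff_distrib)
qed

section \<open>Gradients\<close>

text \<open>Frechet derivatives are unique and a vector is determined by its inner products, so the
  description in \<open>gradient\<close> has exactly one candidate.\<close>

lemma gradient_eq:
  assumes "GDERIV g x :> D"
  shows "gradient g x = D"
  unfolding gradient_def
proof (rule the_equality[where a = D])
  fix D' assume "GDERIV g x :> D'"
  then have "(\<lambda>h. h \<bullet> D') = (\<lambda>h. h \<bullet> D)"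
    using assms has_derivative_unique unfolding gderiv_def by blast
  then show "D' = D"
    by (metis inner_commute vector_eq_ldot)
qed fact

text \<open>Riesz representation in finite dimension: a linear functional is represented by its
  adjoint evaluated at 1.\<close>

lemma GDERIV_gradient:
  fixes g :: "'a::euclidean_space \<Rightarrow> real"
  assumes "g differentiable (at x)"
  shows "GDERIV g x :> gradient g x"
proof -
  obtain g' where g': "(g has_derivative g') (at x)"
    using assms by (auto simp: differentiable_def)
  then have "g' = (\<lambda>h. h \<bullet> adjoint g' 1)"
    using adjoint_works[OF has_derivative_linear[OF g'], of _ 1] by (auto simp: fun_eq_iff)
  then have "GDERIV g x :> adjoint g' 1"
    using g' by (simp add: gderiv_def)
  then show ?thesis
    using gradient_eq by metis
qed

text \<open>Chain rule along the line through \<open>z\<close> in direction \<open>v\<close>. Only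
  the limit from the right is kept, because the occupation derivative is one-sided.\<close>

lemma tendsto_directional_derivative:
  fixes g :: "'a::euclidean_space \<Rightarrow> real"
  assumes "g differentiable (at z)"
  shows "((\<lambda>h. (g (z + h *\<^sub>R v) - g z) / h) \<longlongrightarrow> gradient g z \<bullet> v) (at_right 0)"
proof -
  have "((\<lambda>h. g (z + h *\<^sub>R v)) has_derivative (\<lambda>h. (h *\<^sub>R v) \<bullet> gradient g z)) (at 0)"
  proof (rule has_derivative_compose[where g = g])
    show "((\<lambda>h. z + h *\<^sub>R v) has_derivative (\<lambda>h. h *\<^sub>R v)) (at 0)"
      by (auto intro!: derivative_eq_intros)
    show "(g has_derivative (\<lambda>y. y \<bullet> gradient g z)) (at (z + 0 *\<^sub>R v))"
      using GDERIV_gradient[OF assms] by (simp add: gderiv_def)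
  qed
  then have "((\<lambda>h. g (z + h *\<^sub>R v)) has_real_derivative gradient g z \<bullet> v) (at 0)"
    by (simp add: has_field_derivative_def inner_commute mult_commute_abs)
  then have "((\<lambda>h. (g (z + h *\<^sub>R v) - g z) / h) \<longlongrightarrow> gradient g z \<bullet> v) (at 0)"
    by (simp add: has_field_derivative_iff)
  then show ?thesis
    by (rule tendsto_within_subset) simp
qed

section \<open>Cylindrical test functions\<close>

lemma separating_family_bcontfun: "separating_family f \<Longrightarrow> range f \<subseteq> bcontfun"
  by (auto simp: separating_family_def C1b_def)

text \<open>Serves twice: for continuity of the occupation derivative of cylindrical functions, and
  for passing to the limit in \<open>contract\<close> when the base point \<open>x\<close>
  moves.\<close>

lemma continuous_on_evalK:
  fixes f :: "nat \<Rightarrow> real ^ 'd \<Rightarrow> real" and idx :: "'k::finite \<Rightarrow> nat"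
  assumes "range f \<subseteq> bcontfun"
  shows "continuous_on UNIV (evalK f idx)"
  unfolding evalK_def using assms by (intro continuous_intros) (auto simp: bcontfun_def image_subset_iff)

lemma bcontfun_integrable:
  fixes g :: "real ^ 'd \<Rightarrow> real"
  assumes "g \<in> bcontfun" "\<mu> \<in> fin_borel_measures"
  shows "integrable \<mu> g"
proof -
  interpret finite_measure \<mu> using assms(2) by (simp add: fin_borel_measures_def)
  have [measurable_cong]: "sets \<mu> = sets borel" using assms(2) by (simp add: fin_borel_measures_def)
  have "g \<in> borel_measurable borel"
    using assms(1) by (auto simp: bcontfun_def intro: borel_measurable_continuous_onI)
  then have [measurable]: "g \<in> borel_measurable \<mu>" by measurable
  obtain B where "\<And>y. norm (g y) \<le> B"
    using assms(1) by (auto simp: bcontfun_def bounded_iff)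
  then show ?thesis
    by (intro integrable_const_bound[where B = B]) auto
qed

text \<open>Integrals are additive and positively homogeneous in the measure, and a Dirac mass
  evaluates the integrand. The sign of \<open>h\<close> matters, since \<open>ennreal\<close> sends
  negative reals to 0.\<close>

lemma piK_add_dirac:
  fixes f :: "nat \<Rightarrow> real ^ 'd \<Rightarrow> real" and idx :: "'k::finite \<Rightarrow> nat"
  assumes f: "range f \<subseteq> bcontfun" and \<mu>: "\<mu> \<in> fin_borel_measures" and h: "0 \<le> h"
  shows "piK f idx (add_measure \<mu> (scale_measure (ennreal h) (return borel x)))
           = piK f idx \<mu> + h *\<^sub>R evalK f idx x"
proof -
  have fk: "f k \<in> bcontfun" for k using f by auto
  have \<delta>: "return borel x \<in> fin_borel_measures"
    by (simp add: fin_borel_measures_def prob_space.finite_measure prob_space_return)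
  have "(\<integral>y. f k y \<partial>add_measure \<mu> (scale_measure (ennreal h) (return borel x)))
      = (\<integral>y. f k y \<partial>\<mu>) + h * f k x" for k
  proof -
    have "f k \<in> borel_measurable borel"
      using fk[of k] by (auto simp: bcontfun_def intro: borel_measurable_continuous_onI)
    then show ?thesis
      using \<mu> h bcontfun_integrable[OF fk \<mu>, of k] bcontfun_integrable[OF fk \<delta>, of k]
      by (simp add: integral_add_measure integral_scale_measure integrable_scale_measure
          fin_borel_measures_def integral_return)
  qed
  then show ?thesis
    by (simp add: piK_def evalK_def vec_eq_iff)
qed

section \<open>Continuity of the projection in the weak topology\<close>

lemma topspace_weak_topology: "topspace weak_topology = fin_borel_measures"
  by (simp add: weak_topology_def topspace_pullback_topology)

lemma Mq_subset: "Mq \<subseteq> fin_borel_measures"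
  by (auto simp: Mq_def)

lemma MT_subset: "MT T \<subseteq> Mq"
  by (auto simp: MT_def)

lemma topspace_D_top: "topspace D_top = Mq \<times> UNIV"
  using Mq_subset by (auto simp: D_top_def topspace_weak_topology)

lemma topspace_DT_top: "topspace (DT_top T) = DT T"
  using Mq_subset MT_subset[of T] by (auto simp: DT_top_def DT_def topspace_weak_topology)

text \<open>The weak topology is pulled back from a product indexed by bounded continuous functions,
  and \<open>piK\<close> reads off finitely many coordinates of that product.\<close>

lemma continuous_map_piK:
  fixes f :: "nat \<Rightarrow> real ^ 'd \<Rightarrow> real" and idx :: "'k::finite \<Rightarrow> nat"
  assumes f: "range f \<subseteq> bcontfun"
  shows "continuous_map weak_topology euclidean (piK f idx)"
proof -
  let ?I = "\<lambda>\<mu> (g :: (real ^ 'd) \<Rightarrow>\<^sub>C real). \<integral>y. apply_bcontfun g y \<partial>\<mu>"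
  have "continuous_on UNIV (\<lambda>F :: ((real ^ 'd) \<Rightarrow>\<^sub>C real) \<Rightarrow> real. \<chi> j::'k. F (Bcontfun (f (idx j))))"
    by (intro continuous_on_vec_lambda continuous_on_product_coordinates)
  then have "continuous_map weak_topology euclidean
      ((\<lambda>F :: ((real ^ 'd) \<Rightarrow>\<^sub>C real) \<Rightarrow> real. \<chi> j::'k. F (Bcontfun (f (idx j)))) \<circ> ?I)"
    unfolding weak_topology_def by (intro continuous_map_pullback) simp
  moreover have "(\<lambda>F. \<chi> j::'k. F (Bcontfun (f (idx j)))) \<circ> ?I = piK f idx"
    using f by (auto simp: fun_eq_iff piK_def Bcontfun_inverse image_subset_iff)
  ultimately show ?thesis by simp
qed

lemma continuous_map_D_top_project:
  fixes f :: "nat \<Rightarrow> real ^ 'd \<Rightarrow> real" and idx :: "'k::finite \<Rightarrow> nat"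
  assumes f: "range f \<subseteq> bcontfun"
  shows "continuous_map D_top euclidean (\<lambda>(\<mu>, y). (piK f idx \<mu>, y))"
proof -
  have "continuous_map D_top (prod_topology euclidean euclidean) (\<lambda>\<xi>. (piK f idx (fst \<xi>), snd \<xi>))"
    unfolding D_top_def
    by (intro continuous_map_pairedI continuous_map_snd
        continuous_map_compose[OF continuous_map_fst, unfolded comp_def]
        continuous_map_from_subtopology continuous_map_piK f)
  then show ?thesis by (simp add: case_prod_unfold euclidean_product_topology)
qed

section \<open>Pullbacks of finite-dimensional test functions under the projection\<close>

context
  fixes f :: "nat \<Rightarrow> real ^ 'd \<Rightarrow> real" and idx :: "'k::finite \<Rightarrow> nat"
    and \<phi> :: "(real ^ 'k) \<times> (real ^ 'd) \<Rightarrow> real"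
  assumes f: "range f \<subseteq> bcontfun" and \<phi>: "\<phi> \<in> C12_fin"
begin

lemma occ_quotient_cylindrical:
  assumes "\<xi> \<in> Mq \<times> UNIV"
  shows "(occ_quotient (\<lambda>(\<mu>, y). \<phi> (piK f idx \<mu>, y)) \<xi>
           \<longlongrightarrow> grad_z \<phi> (piK f idx (fst \<xi>), snd \<xi>) \<bullet> evalK f idx (snd \<xi>)) (at_right 0)"
proof -
  obtain \<mu> x where \<xi>: "\<xi> = (\<mu>, x)" and \<mu>: "\<mu> \<in> fin_borel_measures"
    using assms Mq_subset by (cases \<xi>) auto
  let ?z = "piK f idx \<mu>"
  have "((\<lambda>h. (\<phi> (?z + h *\<^sub>R evalK f idx x, x) - \<phi> (?z, x)) / h)
          \<longlongrightarrow> gradient (\<lambda>y. \<phi> (y, x)) ?z \<bullet> evalK f idx x) (at_right 0)"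
    using \<phi> by (intro tendsto_directional_derivative) (simp add: C12_fin_def)
  then show ?thesis
    unfolding \<xi> grad_z_def prod.case fst_conv snd_conv
    \<comment> \<open>For \<open>h\<close> between 0 and 1, \<open>piK_add_dirac\<close> turns the
      occupation quotient into the directional difference quotient of \<phi> in
      \<open>z\<close>.\<close>
    by (rule Lim_transform_eventually)
       (auto simp: occ_quotient_def piK_add_dirac[OF f \<mu>]
          intro!: eventually_at_rightI[of 0 1])
qed

lemma occ_deriv_cylindrical:
  assumes "\<xi> \<in> Mq \<times> UNIV"
  shows "occ_deriv (\<lambda>(\<mu>, y). \<phi> (piK f idx \<mu>, y)) \<xi>
           = grad_z \<phi> (piK f idx (fst \<xi>), snd \<xi>) \<bullet> evalK f idx (snd \<xi>)"
  unfolding occ_deriv_def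
  by (intro tendsto_Lim occ_quotient_cylindrical assms) simp

text \<open>Each derivative of the pullback is a continuous function on the finite-dimensional space
  composed with the continuous projection \<open>?G\<close>; derivatives in \<open>x\<close> keep
  the measure fixed and are simply those of \<phi>.\<close>

lemma cylindrical_C12_D: "(\<lambda>(\<mu>, y). \<phi> (piK f idx \<mu>, y)) \<in> C12_D"
proof -
  let ?\<psi> = "\<lambda>(\<mu>, y). \<phi> (piK f idx \<mu>, y)" and ?G = "\<lambda>(\<mu>, y). (piK f idx \<mu>, y)"
  have G: "continuous_map D_top euclidean ?G"
    by (intro continuous_map_D_top_project f)
  have comp: "continuous_map D_top euclidean (\<lambda>\<xi>. g (?G \<xi>))"
    if "continuous_on UNIV g" for g :: "(real ^ 'k) \<times> (real ^ 'd) \<Rightarrow> 'c::topological_space"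
    using continuous_map_compose[OF G, of euclidean g] that by (simp add: comp_def)
  have "continuous_on UNIV (\<lambda>p. grad_z \<phi> p \<bullet> evalK f idx (snd p))"
    using \<phi> by (intro continuous_intros continuous_on_compose2[OF continuous_on_evalK[OF f]])
      (auto simp: C12_fin_def)
  \<comment> \<open>The formula for the occupation derivative is available only on
    \<open>Mq \<times> UNIV\<close>; this is the whole \<open>topspace\<close>, so agreement there
    transfers continuity.\<close>
  from comp[OF this] have "continuous_map D_top euclidean (occ_deriv ?\<psi>)"
    by (rule continuous_map_eq) (auto simp: topspace_D_top occ_deriv_cylindrical)
  moreover have "continuous_map D_top euclidean ?\<psi>"
    using comp[of \<phi>] \<phi> by (simp add: C12_fin_def case_prod_unfold)
  moreover have "continuous_map D_top euclidean (grad_x ?\<psi>)"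
    using comp[of "grad_x \<phi>"] \<phi> by (simp add: C12_fin_def grad_x_def case_prod_unfold)
  moreover have "continuous_map D_top euclidean (hess_x ?\<psi>)"
    using comp[of "hess_x \<phi>"] \<phi> by (simp add: C12_fin_def hess_x_def case_prod_unfold)
  moreover have "occ_differentiable ?\<psi> \<xi>" if "\<xi> \<in> Mq \<times> UNIV" for \<xi>
    using occ_quotient_cylindrical[OF that] unfolding occ_differentiable_def by blast
  moreover have "twice_differentiable_x ?\<psi> \<xi>" for \<xi>
    using \<phi> by (simp add: C12_fin_def twice_differentiable_x_def case_prod_unfold)
  ultimately show ?thesis
    by (simp add: C12_D_def)
qed

lemma derivs_cylindrical:
  assumes "\<mu> \<in> Mq"
  shows "contract f idx x (grad_z \<phi> (piK f idx \<mu>, x), grad_x \<phi> (piK f idx \<mu>, x), hess_x \<phi> (piK f idx \<mu>, x))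
    = (occ_deriv (\<lambda>(\<mu>, y). \<phi> (piK f idx \<mu>, y)) (\<mu>, x),
       grad_x (\<lambda>(\<mu>, y). \<phi> (piK f idx \<mu>, y)) (\<mu>, x),
       hess_x (\<lambda>(\<mu>, y). \<phi> (piK f idx \<mu>, y)) (\<mu>, x))"
  using assms by (simp add: contract_def occ_deriv_cylindrical grad_x_def hess_x_def)

end

section \<open>Semijet inclusions\<close>

lemma jetK_minus_subset:
  fixes f :: "nat \<Rightarrow> real ^ 'd \<Rightarrow> real" and idx :: "'k::finite \<Rightarrow> nat"
  assumes f: "range f \<subseteq> bcontfun" and \<mu>: "\<mu> \<in> minimizers T f idx w z x"
  shows "jetK_minus T f idx (Pi_inf T f idx w) z x \<subseteq> jet_minus T w (\<mu>, x)"
proof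
  let ?W = "Pi_inf T f idx w"
  fix \<zeta> assume "\<zeta> \<in> jetK_minus T f idx ?W z x"
  then obtain \<phi> where \<phi>: "\<phi> \<in> C12_fin"
    and \<zeta>: "\<zeta> = contract f idx x (grad_z \<phi> (z, x), grad_x \<phi> (z, x), hess_x \<phi> (z, x))"
    and touch: "?W (z, x) - ereal (\<phi> (z, x)) = 0"
    and above: "\<And>r. r \<in> RK T f idx \<times> UNIV \<Longrightarrow> ?W r - ereal (\<phi> r) \<ge> 0"
    by (auto simp: jetK_minus_def jet_minus_fin_def)
  have \<mu>T: "\<mu> \<in> MT T" and z: "piK f idx \<mu> = z" and att: "ereal (w (\<mu>, x)) = ?W (z, x)"
    using \<mu> by (auto simp: minimizers_def)
  let ?\<psi> = "\<lambda>(\<mu>, y). \<phi> (piK f idx \<mu>, y)"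
  have "w \<eta> - ?\<psi> \<eta> \<ge> 0" if \<eta>T: "\<eta> \<in> DT T" for \<eta>
  proof -
    obtain \<nu> y where \<eta>: "\<eta> = (\<nu>, y)" "\<nu> \<in> MT T" using \<eta>T by (auto simp: DT_def)
    \<comment> \<open>\<open>?W\<close> may be infinite, so the sign of the \<open>ereal\<close>
      difference is converted to an inequality by cases; \<phi> is real.\<close>
    have "?W (piK f idx \<nu>, y) \<ge> ereal (\<phi> (piK f idx \<nu>, y))"
      using above[of "(piK f idx \<nu>, y)"] \<eta>(2)
      by (cases "?W (piK f idx \<nu>, y)") (auto simp: RK_def)
    moreover have "?W (piK f idx \<nu>, y) \<le> ereal (w (\<nu>, y))"
      using \<eta>(2) by (auto simp: Pi_inf_def intro: INF_lower)
    ultimately show ?thesis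
      using \<eta>(1) by (auto dest: order_trans)
  qed
  \<comment> \<open>Attainment by \<mu> replaces the extended value \<open>?W (z, x)\<close> by the
    real number \<open>w (\<mu>, x)\<close>.\<close>
  moreover have "w (\<mu>, x) - ?\<psi> (\<mu>, x) = 0"
    using touch z by (simp flip: att)
  moreover have "\<zeta> = (occ_deriv ?\<psi> (\<mu>, x), grad_x ?\<psi> (\<mu>, x), hess_x ?\<psi> (\<mu>, x))"
    using derivs_cylindrical[OF f \<phi>, where \<mu> = \<mu> and x = x and idx = idx] \<mu>T MT_subset z \<zeta> by auto
  moreover have "?\<psi> \<in> C12_D"
    by (rule cylindrical_C12_D[OF f \<phi>])
  ultimately show "\<zeta> \<in> jet_minus T w (\<mu>, x)"
    using \<mu>T unfolding jet_minus_def by (auto simp: DT_def)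
qed

text \<open>The mirror argument, with the supremum dominating \<open>u\<close> on each fibre. It is
  carried out directly, since negating \<open>u\<close> would also negate the jets.\<close>

lemma jetK_plus_subset:
  fixes f :: "nat \<Rightarrow> real ^ 'd \<Rightarrow> real" and idx :: "'k::finite \<Rightarrow> nat"
  assumes f: "range f \<subseteq> bcontfun" and \<mu>: "\<mu> \<in> maximizers T f idx u z x"
  shows "jetK_plus T f idx (Pi_sup T f idx u) z x \<subseteq> jet_plus T u (\<mu>, x)"
proof
  let ?U = "Pi_sup T f idx u"
  fix \<zeta> assume "\<zeta> \<in> jetK_plus T f idx ?U z x"
  then obtain \<phi> where \<phi>: "\<phi> \<in> C12_fin"
    and \<zeta>: "\<zeta> = contract f idx x (grad_z \<phi> (z, x), grad_x \<phi> (z, x), hess_x \<phi> (z, x))"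
    and touch: "?U (z, x) - ereal (\<phi> (z, x)) = 0"
    and below: "\<And>r. r \<in> RK T f idx \<times> UNIV \<Longrightarrow> ?U r - ereal (\<phi> r) \<le> 0"
    by (auto simp: jetK_plus_def jet_plus_fin_def)
  have \<mu>T: "\<mu> \<in> MT T" and z: "piK f idx \<mu> = z" and att: "ereal (u (\<mu>, x)) = ?U (z, x)"
    using \<mu> by (auto simp: maximizers_def)
  let ?\<psi> = "\<lambda>(\<mu>, y). \<phi> (piK f idx \<mu>, y)"
  have "u \<eta> - ?\<psi> \<eta> \<le> 0" if \<eta>T: "\<eta> \<in> DT T" for \<eta>
  proof -
    obtain \<nu> y where \<eta>: "\<eta> = (\<nu>, y)" "\<nu> \<in> MT T" using \<eta>T by (auto simp: DT_def)
    have "?U (piK f idx \<nu>, y) \<le> ereal (\<phi> (piK f idx \<nu>, y))"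
      using below[of "(piK f idx \<nu>, y)"] \<eta>(2)
      by (cases "?U (piK f idx \<nu>, y)") (auto simp: RK_def)
    moreover have "ereal (u (\<nu>, y)) \<le> ?U (piK f idx \<nu>, y)"
      using \<eta>(2) by (auto simp: Pi_sup_def intro: SUP_upper)
    ultimately show ?thesis
      using \<eta>(1) by (auto dest: order_trans)
  qed
  moreover have "u (\<mu>, x) - ?\<psi> (\<mu>, x) = 0"
    using touch z by (simp flip: att)
  moreover have "\<zeta> = (occ_deriv ?\<psi> (\<mu>, x), grad_x ?\<psi> (\<mu>, x), hess_x ?\<psi> (\<mu>, x))"
    using derivs_cylindrical[OF f \<phi>, where \<mu> = \<mu> and x = x and idx = idx] \<mu>T MT_subset z \<zeta> by auto
  moreover have "?\<psi> \<in> C12_D"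
    by (rule cylindrical_C12_D[OF f \<phi>])
  ultimately show "\<zeta> \<in> jet_plus T u (\<mu>, x)"
    using \<mu>T unfolding jet_plus_def by (auto simp: DT_def)
qed

section \<open>Compactness of sublevel sets and semijet closures\<close>

text \<open>The compactness step, used both for minimizing sequences in one fibre and for minimizers
  over moving base points. The level \<open>c\<close> may be minus infinity a priori; the last
  conclusion rules this out, as \<open>w (\<mu>, x)\<close> is real.\<close>

lemma lower_coercive_limit:
  fixes f :: "nat \<Rightarrow> real ^ 'd \<Rightarrow> real" and idx :: "'k::finite \<Rightarrow> nat" and c :: ereal
  assumes f: "range f \<subseteq> bcontfun" and w: "lower_coercive T w"
    and \<xi>: "\<And>n. \<xi> n \<in> DT T" and c: "(\<lambda>n. ereal (w (\<xi> n))) \<longlonglongrightarrow> c" "c < \<infinity>"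
    and z: "(\<lambda>n. piK f idx (fst (\<xi> n))) \<longlonglongrightarrow> z" and x: "(\<lambda>n. snd (\<xi> n)) \<longlonglongrightarrow> x"
  obtains r \<mu> where "strict_mono r" "limitin (DT_top T) (\<xi> \<circ> r) (\<mu>, x) sequentially"
    "\<mu> \<in> MT T" "piK f idx \<mu> = z" "ereal (w (\<mu>, x)) \<le> c"
proof -
  obtain B where B: "c < ereal B" using c(2) less_PInf_Ex_of_nat by blast
  obtain N where N: "\<And>n. n \<ge> N \<Longrightarrow> w (\<xi> n) \<le> B"
    using order_tendstoD(2)[OF c(1) B] unfolding eventually_sequentially by (auto intro: less_imp_le)
  \<comment> \<open>Coercivity asks for a bound on every term, while convergence to \<open>c\<close>
    bounds only a tail; hence the shift by \<open>N\<close>.\<close>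
  have "\<forall>n. (\<xi> \<circ> (\<lambda>n. n + N)) n \<in> DT T \<and> w ((\<xi> \<circ> (\<lambda>n. n + N)) n) \<le> B"
    using \<xi> N by simp
  then obtain s l where s: "strict_mono s"
      "limitin (DT_top T) ((\<xi> \<circ> (\<lambda>n. n + N)) \<circ> s) l sequentially"
    using w unfolding lower_coercive_def by blast
  define r where "r = (\<lambda>n. n + N) \<circ> s"
  have r: "strict_mono r" using s(1) by (auto simp: r_def strict_mono_def)
  have lim: "limitin (DT_top T) (\<xi> \<circ> r) l sequentially"
    using s(2) by (simp add: r_def comp_assoc)
  obtain \<mu> y where l: "l = (\<mu>, y)" by force
  have \<mu>: "\<mu> \<in> MT T"
    using limitin_topspace[OF lim] by (simp add: topspace_DT_top DT_def l)
  have lim': "limitin (subtopology weak_topology (MT T)) (fst \<circ> (\<xi> \<circ> r)) \<mu> sequentially"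
      "(\<lambda>n. snd (\<xi> (r n))) \<longlonglongrightarrow> y"
    using lim unfolding DT_top_def limitin_pairwise by (auto simp: l comp_def)
  have "y = x"
    using LIMSEQ_unique lim'(2) LIMSEQ_subseq_LIMSEQ[OF x r] by (auto simp: comp_def)
  moreover have "piK f idx \<mu> = z"
  proof -
    have "(\<lambda>n. piK f idx (fst (\<xi> (r n)))) \<longlonglongrightarrow> piK f idx \<mu>"
      using continuous_map_limit[OF continuous_map_from_subtopology[OF continuous_map_piK[OF f]] lim'(1)]
      by (simp add: comp_def)
    then show ?thesis
      using LIMSEQ_unique LIMSEQ_subseq_LIMSEQ[OF z r] by (auto simp: comp_def)
  qed
  \<comment> \<open>Lower semicontinuity: otherwise some real \<open>a\<close> separates
    \<open>c\<close> from \<open>w l\<close>. The open set where \<open>w\<close> exceeds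
    \<open>a\<close> captures a tail of the subsequence, whose values tend to \<open>c\<close> and
    so fall below \<open>a\<close>.\<close>
  moreover have "ereal (w l) \<le> c"
  proof (rule ccontr)
    assume "\<not> ereal (w l) \<le> c"
    then obtain a where a: "c < ereal a" "a < w l"
      using ereal_dense2[of c "ereal (w l)"] by (metis less_ereal.simps(1) not_le)
    have "openin (DT_top T) {\<xi> \<in> topspace (DT_top T). w \<xi> > a}"
      using w by (simp add: lower_coercive_def lsc_def)
    then have "eventually (\<lambda>n. w (\<xi> (r n)) > a) sequentially"
      using lim a(2) unfolding limitin_def by (force dest!: spec elim: eventually_mono)
    moreover have "eventually (\<lambda>n. ereal (w (\<xi> (r n))) < ereal a) sequentially"
      using order_tendstoD(2)[OF LIMSEQ_subseq_LIMSEQ[OF c(1) r] a(1)] by (simp add: comp_def)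
    ultimately have "eventually (\<lambda>n. False) sequentially"
      by eventually_elim simp
    then show False by simp
  qed
  ultimately show thesis
    using that[OF r] lim \<mu> by (simp add: l)
qed

text \<open>The direct method. As \<open>z\<close> lies in \<open>RK\<close>, the fibre is nonempty
  and the infimum is below infinity; a minimizing sequence subconverges within the fibre to a point
  whose value is at most the infimum.\<close>

lemma minimizers_nonempty:
  fixes f :: "nat \<Rightarrow> real ^ 'd \<Rightarrow> real" and idx :: "'k::finite \<Rightarrow> nat"
  assumes f: "range f \<subseteq> bcontfun" and w: "lower_coercive T w" and z: "z \<in> RK T f idx"
  shows "minimizers T f idx w z x \<noteq> {}"
proof -
  let ?S = "{\<mu> \<in> MT T. piK f idx \<mu> = z}"
  have W: "Pi_inf T f idx w (z, x) = (INF \<mu>\<in>?S. ereal (w (\<mu>, x)))"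
    by (simp add: Pi_inf_def)
  obtain \<mu>0 where \<mu>0: "\<mu>0 \<in> ?S" using z by (auto simp: RK_def)
  then obtain v where v: "\<And>n. v n \<in> (\<lambda>\<mu>. ereal (w (\<mu>, x))) ` ?S"
      and "v \<longlonglongrightarrow> (INF \<mu>\<in>?S. ereal (w (\<mu>, x)))"
    using Inf_as_limit[of "(\<lambda>\<mu>. ereal (w (\<mu>, x))) ` ?S"] by blast
  moreover from v obtain m where "\<And>n. m n \<in> ?S" "v = (\<lambda>n. ereal (w (m n, x)))"
    unfolding image_iff Bex_def fun_eq_iff by metis
  ultimately have m: "\<And>n. m n \<in> ?S"
    "(\<lambda>n. ereal (w (m n, x))) \<longlonglongrightarrow> Pi_inf T f idx w (z, x)"
    unfolding W by auto
  have "Pi_inf T f idx w (z, x) \<le> ereal (w (\<mu>0, x))"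
    unfolding W by (rule INF_lower) fact
  then have fin: "Pi_inf T f idx w (z, x) < \<infinity>" by (auto intro: le_less_trans)
  obtain \<mu> where \<mu>: "\<mu> \<in> MT T" "piK f idx \<mu> = z" "ereal (w (\<mu>, x)) \<le> Pi_inf T f idx w (z, x)"
    by (rule lower_coercive_limit[OF f w, where \<xi> = "\<lambda>n. (m n, x)" and idx = idx and z = z and x = x])
       (use m(1) m(2) fin in \<open>simp_all add: DT_def\<close>)
  moreover have "Pi_inf T f idx w (z, x) \<le> ereal (w (\<mu>, x))"
    unfolding W by (rule INF_lower) (use \<mu> in simp)
  ultimately show ?thesis by (auto simp: minimizers_def)
qed

text \<open>Stated for arbitrary jet families \<open>P\<close> and \<open>Q\<close>, so that it can be applied to \<open>- u\<close> for the upper semijets of \<open>u\<close>.\<close>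

lemma jet_closure_minimizers:
  fixes f :: "nat \<Rightarrow> real ^ 'd \<Rightarrow> real" and idx :: "'k::finite \<Rightarrow> nat"
  assumes f: "range f \<subseteq> bcontfun" and w: "lower_coercive T w" and z: "z \<in> RK T f idx"
    and PR: "\<And>p. P p \<noteq> {} \<Longrightarrow> p \<in> RK T f idx \<times> UNIV"
    and PQ: "\<And>z x \<mu>. \<mu> \<in> minimizers T f idx w z x \<Longrightarrow> contract f idx x ` P (z, x) \<subseteq> Q (\<mu>, x)"
    and \<zeta>: "\<zeta> \<in> jet_closure (top_of_set (RK T f idx \<times> UNIV)) (Pi_inf T f idx w) P (z, x)"
  shows "\<exists>\<mu>\<in>minimizers T f idx w z x. contract f idx x \<zeta> \<in> jet_closure (DT_top T) w Q (\<mu>, x)"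
proof -
  let ?W = "Pi_inf T f idx w"
  obtain p \<zeta>s where \<zeta>s: "\<And>n. \<zeta>s n \<in> P (p n)"
    and p: "limitin (top_of_set (RK T f idx \<times> UNIV)) p (z, x) sequentially"
    and W: "(\<lambda>n. ?W (p n)) \<longlonglongrightarrow> ?W (z, x)" and \<zeta>lim: "\<zeta>s \<longlonglongrightarrow> \<zeta>"
    using \<zeta> unfolding jet_closure_def by blast
  have plim: "p \<longlonglongrightarrow> (z, x)"
    using p by (simp add: limitin_subtopology)
  \<comment> \<open>A nonempty jet at \<open>p n\<close> places this point over \<open>RK\<close>,
    where minimizers exist.\<close>
  have "\<exists>\<mu>. \<mu> \<in> minimizers T f idx w (fst (p n)) (snd (p n))" for n
    using minimizers_nonempty[OF f w, where z = "fst (p n)"] PR[of "p n"] \<zeta>s[of n] by fastforce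
  then obtain m where m: "\<And>n. m n \<in> minimizers T f idx w (fst (p n)) (snd (p n))"
    by metis
  define \<xi> where "\<xi> n = (m n, snd (p n))" for n
  have \<xi>: "\<xi> n \<in> DT T" "piK f idx (fst (\<xi> n)) = fst (p n)" "snd (\<xi> n) = snd (p n)"
    "ereal (w (\<xi> n)) = ?W (p n)" for n
    using m[of n] by (auto simp: \<xi>_def minimizers_def DT_def)
  obtain \<mu>0 where "\<mu>0 \<in> minimizers T f idx w z x"
    using minimizers_nonempty[OF f w z] by blast
  then have fin: "?W (z, x) < \<infinity>"
    by (auto simp: minimizers_def simp flip: less_top)
  obtain r \<mu> where r: "strict_mono r" and lim: "limitin (DT_top T) (\<xi> \<circ> r) (\<mu>, x) sequentially"
    and \<mu>: "\<mu> \<in> MT T" "piK f idx \<mu> = z" "ereal (w (\<mu>, x)) \<le> ?W (z, x)"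
  proof (rule lower_coercive_limit[OF f w \<xi>(1) _ fin, where idx = idx and z = z and x = x])
    show "(\<lambda>n. ereal (w (\<xi> n))) \<longlonglongrightarrow> ?W (z, x)" using W by (simp add: \<xi>)
    show "(\<lambda>n. piK f idx (fst (\<xi> n))) \<longlonglongrightarrow> z" "(\<lambda>n. snd (\<xi> n)) \<longlonglongrightarrow> x"
      using tendsto_fst[OF plim] tendsto_snd[OF plim] by (simp_all add: \<xi>)
  qed
  have "?W (z, x) \<le> ereal (w (\<mu>, x))"
    unfolding Pi_inf_def prod.case by (rule INF_lower) (use \<mu> in simp)
  \<comment> \<open>The two inequalities make the limit measure a minimizer and the infimum a real
    number, so that convergence of values in \<open>ereal\<close> becomes convergence of
    reals.\<close>
  with \<mu> have W\<mu>: "?W (z, x) = ereal (w (\<mu>, x))" and min: "\<mu> \<in> minimizers T f idx w z x"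
    by (auto simp: minimizers_def)
  have "(\<lambda>n. ereal (w (\<xi> (r n)))) \<longlonglongrightarrow> ereal (w (\<mu>, x))"
    using LIMSEQ_subseq_LIMSEQ[OF W r] by (simp add: \<xi> comp_def W\<mu>)
  then have "(\<lambda>n. w ((\<xi> \<circ> r) n)) \<longlonglongrightarrow> w (\<mu>, x)" by simp
  moreover have "contract f idx (snd (p (r n))) (\<zeta>s (r n)) \<in> Q ((\<xi> \<circ> r) n)" for n
    using PQ[OF m[of "r n"]] \<zeta>s[of "r n"] by (auto simp: \<xi>_def)
  \<comment> \<open>The contraction is taken at the moving points \<open>snd (p (r n))\<close>, so
    its convergence needs continuity of \<open>evalK\<close> as well as that of the jets.\<close>
  moreover have "(\<lambda>n. contract f idx (snd (p (r n))) (\<zeta>s (r n))) \<longlonglongrightarrow> contract f idx x \<zeta>"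
  proof -
    have x: "(\<lambda>n. snd (p (r n))) \<longlonglongrightarrow> x"
      using LIMSEQ_subseq_LIMSEQ[OF tendsto_snd[OF plim] r] by (simp add: comp_def)
    have *: "(\<lambda>n. \<zeta>s (r n)) \<longlonglongrightarrow> \<zeta>"
      using LIMSEQ_subseq_LIMSEQ[OF \<zeta>lim r] by (simp add: comp_def)
    have "(\<lambda>n. evalK f idx (snd (p (r n)))) \<longlonglongrightarrow> evalK f idx x"
      using continuous_on_tendsto_compose[OF continuous_on_evalK[OF f] x] by simp
    then show ?thesis
      unfolding contract_def case_prod_unfold by (intro tendsto_intros *)
  qed
  ultimately have "contract f idx x \<zeta> \<in> jet_closure (DT_top T) w Q (\<mu>, x)"
    unfolding jet_closure_def using lim
    by (intro CollectI exI[of _ "\<xi> \<circ> r"] exI[of _ "\<lambda>n. contract f idx (snd (p (r n))) (\<zeta>s (r n))"]) simp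
  then show ?thesis
    using min by blast
qed

section \<open>Sign reversal between lower and upper objects\<close>

lemma lsc_uminus: "lsc X (\<lambda>\<xi>. - u \<xi>) \<longleftrightarrow> usc X u"
proof -
  have "lsc X (\<lambda>\<xi>. - u \<xi>) \<longleftrightarrow> (\<forall>c. openin X {\<xi> \<in> topspace X. u \<xi> < - c})"
    by (simp add: lsc_def less_minus_iff)
  also have "\<dots> \<longleftrightarrow> usc X u"
    unfolding usc_def by (metis minus_minus)
  finally show ?thesis .
qed

lemma lower_coercive_uminus:
  assumes "upper_coercive T u"
  shows "lower_coercive T (\<lambda>\<xi>. - u \<xi>)"
  unfolding lower_coercive_def lsc_uminus
proof (intro conjI allI impI)
  show "usc (DT_top T) u"
    using assms by (simp add: upper_coercive_def)
next
  fix c :: real and \<xi> :: "nat \<Rightarrow> _"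
  assume "\<forall>n. \<xi> n \<in> DT T \<and> - u (\<xi> n) \<le> c"
  then have "\<forall>n. \<xi> n \<in> DT T \<and> u (\<xi> n) \<ge> - c"
    by (simp add: minus_le_iff)
  then show "\<exists>r l. strict_mono r \<and> limitin (DT_top T) (\<xi> \<circ> r) l sequentially"
    using assms unfolding upper_coercive_def by blast
qed

lemma Pi_inf_uminus: "Pi_inf T f idx (\<lambda>\<xi>. - u \<xi>) p = - Pi_sup T f idx u p"
  by (cases p) (simp add: Pi_inf_def Pi_sup_def ereal_INF_uminus_eq flip: uminus_ereal.simps(1))

lemma minimizers_uminus: "minimizers T f idx (\<lambda>\<xi>. - u \<xi>) z x = maximizers T f idx u z x"
  by (simp add: minimizers_def maximizers_def Pi_inf_uminus flip: uminus_ereal.simps(1))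

text \<open>The function \<open>v\<close> enters the closure only through convergence of its values,
  which negation preserves; the jet family is left untouched.\<close>

lemma jet_closure_uminus_real:
  fixes v :: "'p \<Rightarrow> real"
  shows "jet_closure X (\<lambda>\<xi>. - v \<xi>) = jet_closure X v"
  by (simp add: jet_closure_def fun_eq_iff tendsto_minus_cancel_left)

lemma jet_closure_uminus_ereal:
  fixes v :: "'p \<Rightarrow> ereal"
  shows "jet_closure X (\<lambda>\<xi>. - v \<xi>) = jet_closure X v"
  by (simp add: jet_closure_def fun_eq_iff ereal_Lim_uminus[symmetric])

section \<open>Inclusions for the closed semijets\<close>

lemma jetK_minus_bar_subset:
  fixes f :: "nat \<Rightarrow> real ^ 'd \<Rightarrow> real" and idx :: "'k::finite \<Rightarrow> nat"
  assumes f: "range f \<subseteq> bcontfun" and w: "lower_coercive T w" and z: "z \<in> RK T f idx"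
  shows "jetK_minus_bar T f idx (Pi_inf T f idx w) z x
    \<subseteq> (\<Union>\<mu> \<in> minimizers T f idx w z x. jet_minus_bar T w (\<mu>, x))"
proof -
  have "\<exists>\<mu>\<in>minimizers T f idx w z x. contract f idx x \<zeta> \<in> jet_minus_bar T w (\<mu>, x)"
    if "\<zeta> \<in> jet_minus_fin_bar (RK T f idx) (Pi_inf T f idx w) (z, x)" for \<zeta>
    unfolding jet_minus_bar_def
  proof (rule jet_closure_minimizers[OF f w z _ _ that[unfolded jet_minus_fin_bar_def]])
    show "contract f idx y ` jet_minus_fin (RK T f idx) (Pi_inf T f idx w) (z, y) \<subseteq> jet_minus T w (\<mu>, y)"
      if "\<mu> \<in> minimizers T f idx w z y" for z y \<mu>
      using jetK_minus_subset[OF f that] by (simp add: jetK_minus_def)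
  qed (auto simp: jet_minus_fin_def)
  then show ?thesis
    by (auto simp: jetK_minus_bar_def)
qed

lemma jetK_plus_bar_subset:
  fixes f :: "nat \<Rightarrow> real ^ 'd \<Rightarrow> real" and idx :: "'k::finite \<Rightarrow> nat"
  assumes f: "range f \<subseteq> bcontfun" and u: "upper_coercive T u" and z: "z \<in> RK T f idx"
  shows "jetK_plus_bar T f idx (Pi_sup T f idx u) z x
    \<subseteq> (\<Union>\<mu> \<in> maximizers T f idx u z x. jet_plus_bar T u (\<mu>, x))"
proof -
  have "\<exists>\<mu>\<in>maximizers T f idx u z x. contract f idx x \<zeta> \<in> jet_plus_bar T u (\<mu>, x)"
    if "\<zeta> \<in> jet_plus_fin_bar (RK T f idx) (Pi_sup T f idx u) (z, x)" for \<zeta>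
  proof -
    \<comment> \<open>Only the value functions change sign; the jet family stays that of the upper
      semijets, so no jet has to be negated.\<close>
    have *: "\<zeta> \<in> jet_closure (top_of_set (RK T f idx \<times> UNIV)) (Pi_inf T f idx (\<lambda>\<xi>. - u \<xi>))
        (jet_plus_fin (RK T f idx) (Pi_sup T f idx u)) (z, x)"
      using that by (simp add: jet_plus_fin_bar_def Pi_inf_uminus[abs_def] jet_closure_uminus_ereal)
    have "\<exists>\<mu>\<in>minimizers T f idx (\<lambda>\<xi>. - u \<xi>) z x.
        contract f idx x \<zeta> \<in> jet_closure (DT_top T) (\<lambda>\<xi>. - u \<xi>) (jet_plus T u) (\<mu>, x)"
    proof (rule jet_closure_minimizers[OF f lower_coercive_uminus[OF u] z _ _ *])
      show "contract f idx y ` jet_plus_fin (RK T f idx) (Pi_sup T f idx u) (z, y) \<subseteq> jet_plus T u (\<mu>, y)"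
        if "\<mu> \<in> minimizers T f idx (\<lambda>\<xi>. - u \<xi>) z y" for z y \<mu>
        using jetK_plus_subset[OF f] that by (simp add: jetK_plus_def minimizers_uminus)
    qed (auto simp: jet_plus_fin_def)
    then show ?thesis
      by (simp add: minimizers_uminus jet_closure_uminus_real jet_plus_bar_def)
  qed
  then show ?thesis
    by (auto simp: jetK_plus_bar_def)
qed

theorem lemma4p7:
  fixes T :: real
    and f :: "nat \<Rightarrow> real ^ 'd \<Rightarrow> real"
    and K :: nat
    and idx :: "'k::finite \<Rightarrow> nat"
    and z :: "real ^ 'k"
    and x :: "real ^ 'd"
  assumes "T > 0"
    and "separating_family f"
    and "K \<ge> 1"
    and "bij_betw idx (UNIV :: 'k set) {1..K}"
    and "z \<in> RK T f idx"
  shows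
    "(\<forall>w. lsc (DT_top T) w \<longrightarrow>
        (let wK = Pi_inf T f idx w in
          (\<forall>\<mu> \<in> minimizers T f idx w z x.
             jetK_minus T f idx wK z x \<subseteq> jet_minus T w (\<mu>, x)) \<and>
          (lower_coercive T w \<longrightarrow>
             jetK_minus_bar T f idx wK z x
               \<subseteq> (\<Union>\<mu> \<in> minimizers T f idx w z x. jet_minus_bar T w (\<mu>, x)))))
     \<and>
     (\<forall>u. usc (DT_top T) u \<longrightarrow>
        (let uK = Pi_sup T f idx u in
          (\<forall>\<mu> \<in> maximizers T f idx u z x.
             jetK_plus T f idx uK z x \<subseteq> jet_plus T u (\<mu>, x)) \<and>
          (upper_coercive T u \<longrightarrow>
             jetK_plus_bar T f idx uK z x
               \<subseteq> (\<Union>\<mu> \<in> maximizers T f idx u z x. jet_plus_bar T u (\<mu>, x)))))"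
proof -
  note f = separating_family_bcontfun[OF \<open>separating_family f\<close>]
  show ?thesis
    unfolding Let_def
    using jetK_minus_subset[OF f] jetK_minus_bar_subset[OF f _ \<open>z \<in> RK T f idx\<close>]
      jetK_plus_subset[OF f] jetK_plus_bar_subset[OF f _ \<open>z \<in> RK T f idx\<close>]
    by (intro conjI allI impI ballI)
qed

end
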